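(* Let $\mathcal S, \mathcal T$ be triangulated categories. Let $R:\mathcal T \to \mathcal S$ be a functor commuting with shifts. Assume $R$ admits a left adjoint $L:\mathcal S \to \mathcal T$. Let $\varepsilon: LR \to 1_{\mathcal T}$ and $\eta: 1_{\mathcal S}\to RL$ be the counit and unit of the adjunction, respectively. Then the following are true: (1) If there exist objects $M$ in $\mathcal S$ and $B$ in $\mathcal T$ such that $M\in \langle R(B) \rangle_1$, then the natural map $\eta_M : M \to RL(M)$ is a split monomorphism. (2) If there exist objects $M$ in $\mathcal S$ and $B$ in $\mathcal T$ such that $B\in \langle L(M) \rangle_1$, then the natural map $\varepsilon_B: LR(B)\to B$ is a split epimorphism.
   Context: For an object $C$ of a triangulated category with shift functor $[1]$, $\langle C\rangle_1$ denotes the strictly full subcategory consisting of all retracts (direct summands) of finite direct sums of shifts $C[n]$, $n\in\mathbb Z$. A functor $R$ commutes with shifts if there is a natural isomorphism $R\circ[1]\cong[1]\circ R$. A split monomorphism is a morphism admitting a left inverse; a split epimorphism is a morphism admitting a right inverse. *)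

theory Defs
  imports "HOL-Algebra.FiniteProduct"
begin

record ('o, 'm) category =
  Ob :: "'o set"
  Ar :: "'m set"
  Dom :: "'m \<Rightarrow> 'o"
  Cod :: "'m \<Rightarrow> 'o"
  Id :: "'o \<Rightarrow> 'm"
  Comp :: "'m \<Rightarrow> 'm \<Rightarrow> 'm"  (infixr "\<cdot>\<index>" 75)

definition Hom :: "('o, 'm, 'x) category_scheme \<Rightarrow> 'o \<Rightarrow> 'o \<Rightarrow> 'm set" where
  "Hom C X Y = {f \<in> Ar C. Dom C f = X \<and> Cod C f = Y}"

locale category =
  fixes C :: "('o, 'm, 'x) category_scheme" (structure)
  assumes Dom_in_Ob: "f \<in> Ar C \<Longrightarrow> Dom C f \<in> Ob C"
    and Cod_in_Ob: "f \<in> Ar C \<Longrightarrow> Cod C f \<in> Ob C"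
    and Id_in_Hom: "X \<in> Ob C \<Longrightarrow> Id C X \<in> Hom C X X"
    and Comp_in_Hom: "\<lbrakk>f \<in> Hom C X Y; g \<in> Hom C Y Z\<rbrakk> \<Longrightarrow> g \<cdot> f \<in> Hom C X Z"
    and Comp_Id_right: "f \<in> Hom C X Y \<Longrightarrow> f \<cdot> Id C X = f"
    and Comp_Id_left: "f \<in> Hom C X Y \<Longrightarrow> Id C Y \<cdot> f = f"
    and Comp_assoc:
      "\<lbrakk>f \<in> Hom C X Y; g \<in> Hom C Y Z; h \<in> Hom C Z W\<rbrakk> \<Longrightarrow> (h \<cdot> g) \<cdot> f = h \<cdot> (g \<cdot> f)"

definition is_iso :: "('o, 'm, 'x) category_scheme \<Rightarrow> 'm \<Rightarrow> bool" where
  "is_iso C f \<longleftrightarrow> f \<in> Ar C \<and>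
    (\<exists>g \<in> Hom C (Cod C f) (Dom C f).
      Comp C g f = Id C (Dom C f) \<and> Comp C f g = Id C (Cod C f))"

definition split_mono :: "('o, 'm, 'x) category_scheme \<Rightarrow> 'm \<Rightarrow> bool" where
  "split_mono C f \<longleftrightarrow> f \<in> Ar C \<and>
    (\<exists>r \<in> Hom C (Cod C f) (Dom C f). Comp C r f = Id C (Dom C f))"

definition split_epi :: "('o, 'm, 'x) category_scheme \<Rightarrow> 'm \<Rightarrow> bool" where
  "split_epi C f \<longleftrightarrow> f \<in> Ar C \<and>
    (\<exists>s \<in> Hom C (Cod C f) (Dom C f). Comp C f s = Id C (Cod C f))"

definition is_retract_of :: "('o, 'm, 'x) category_scheme \<Rightarrow> 'o \<Rightarrow> 'o \<Rightarrow> bool" where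
  "is_retract_of C Y N \<longleftrightarrow> Y \<in> Ob C \<and> N \<in> Ob C \<and>
    (\<exists>i \<in> Hom C Y N. \<exists>p \<in> Hom C N Y. Comp C p i = Id C Y)"

definition is_zero_object :: "('o, 'm, 'x) category_scheme \<Rightarrow> 'o \<Rightarrow> bool" where
  "is_zero_object C Z \<longleftrightarrow> Z \<in> Ob C \<and>
    (\<forall>X \<in> Ob C. (\<exists>!f. f \<in> Hom C X Z) \<and> (\<exists>!f. f \<in> Hom C Z X))"

definition full_subcategory ::
  "('o, 'm, 'x) category_scheme \<Rightarrow> 'o set \<Rightarrow> ('o, 'm) category" where
  "full_subcategory C A =
    \<lparr>Ob = A, Ar = {f \<in> Ar C. Dom C f \<in> A \<and> Cod C f \<in> A},
     Dom = Dom C, Cod = Cod C, Id = Id C, Comp = Comp C\<rparr>"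

record ('o1, 'm1, 'o2, 'm2) cfunctor =
  onOb :: "'o1 \<Rightarrow> 'o2"
  onAr :: "'m1 \<Rightarrow> 'm2"

definition is_functor ::
  "('o1, 'm1, 'x) category_scheme \<Rightarrow> ('o2, 'm2, 'y) category_scheme
    \<Rightarrow> ('o1, 'm1, 'o2, 'm2) cfunctor \<Rightarrow> bool" where
  "is_functor C D F \<longleftrightarrow>
    (\<forall>X \<in> Ob C. onOb F X \<in> Ob D) \<and>
    (\<forall>X \<in> Ob C. \<forall>Y \<in> Ob C. \<forall>f \<in> Hom C X Y. onAr F f \<in> Hom D (onOb F X) (onOb F Y)) \<and>
    (\<forall>X \<in> Ob C. onAr F (Id C X) = Id D (onOb F X)) \<and>
    (\<forall>X \<in> Ob C. \<forall>Y \<in> Ob C. \<forall>Z \<in> Ob C. \<forall>f \<in> Hom C X Y. \<forall>g \<in> Hom C Y Z.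
      onAr F (Comp C g f) = Comp D (onAr F g) (onAr F f))"

definition id_functor :: "('o, 'm, 'o, 'm) cfunctor" where
  "id_functor = \<lparr>onOb = (\<lambda>X. X), onAr = (\<lambda>f. f)\<rparr>"

definition comp_functor ::
  "('o2, 'm2, 'o3, 'm3) cfunctor \<Rightarrow> ('o1, 'm1, 'o2, 'm2) cfunctor
    \<Rightarrow> ('o1, 'm1, 'o3, 'm3) cfunctor"  (infixr "\<circ>\<^sub>F" 75) where
  "G \<circ>\<^sub>F F = \<lparr>onOb = onOb G \<circ> onOb F, onAr = onAr G \<circ> onAr F\<rparr>"

definition is_nat_trans ::
  "('o1, 'm1, 'x) category_scheme \<Rightarrow> ('o2, 'm2, 'y) category_scheme
    \<Rightarrow> ('o1, 'm1, 'o2, 'm2) cfunctor \<Rightarrow> ('o1, 'm1, 'o2, 'm2) cfunctor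
    \<Rightarrow> ('o1 \<Rightarrow> 'm2) \<Rightarrow> bool" where
  "is_nat_trans C D F G \<tau> \<longleftrightarrow>
    (\<forall>X \<in> Ob C. \<tau> X \<in> Hom D (onOb F X) (onOb G X)) \<and>
    (\<forall>X \<in> Ob C. \<forall>Y \<in> Ob C. \<forall>f \<in> Hom C X Y.
      Comp D (\<tau> Y) (onAr F f) = Comp D (onAr G f) (\<tau> X))"

definition naturally_isomorphic ::
  "('o1, 'm1, 'x) category_scheme \<Rightarrow> ('o2, 'm2, 'y) category_scheme
    \<Rightarrow> ('o1, 'm1, 'o2, 'm2) cfunctor \<Rightarrow> ('o1, 'm1, 'o2, 'm2) cfunctor \<Rightarrow> bool" where
  "naturally_isomorphic C D F G \<longleftrightarrow>
    (\<exists>\<tau>. is_nat_trans C D F G \<tau> \<and> (\<forall>X \<in> Ob C. is_iso D (\<tau> X)))"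

text \<open>\<open>L : S \<rightarrow> T\<close> is left adjoint to \<open>R : T \<rightarrow> S\<close> with unit \<open>\<eta>\<close> and counit \<open>\<epsilon>\<close>;
  the last two conjuncts are the triangle identities.\<close>

definition is_adjunction ::
  "('o1, 'm1, 'x) category_scheme \<Rightarrow> ('o2, 'm2, 'y) category_scheme
    \<Rightarrow> ('o1, 'm1, 'o2, 'm2) cfunctor \<Rightarrow> ('o2, 'm2, 'o1, 'm1) cfunctor
    \<Rightarrow> ('o1 \<Rightarrow> 'm1) \<Rightarrow> ('o2 \<Rightarrow> 'm2) \<Rightarrow> bool" where
  "is_adjunction S T L R \<eta> \<epsilon> \<longleftrightarrow>
    is_functor S T L \<and> is_functor T S R \<and>
    is_nat_trans S S id_functor (R \<circ>\<^sub>F L) \<eta> \<and>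
    is_nat_trans T T (L \<circ>\<^sub>F R) id_functor \<epsilon> \<and>
    (\<forall>M \<in> Ob S. Comp T (\<epsilon> (onOb L M)) (onAr L (\<eta> M)) = Id T (onOb L M)) \<and>
    (\<forall>B \<in> Ob T. Comp S (onAr R (\<epsilon> B)) (\<eta> (onOb R B)) = Id S (onOb R B))"

record ('o, 'm) additive_category = "('o, 'm) category" +
  Add :: "'m \<Rightarrow> 'm \<Rightarrow> 'm"  (infixl "\<oplus>\<^sub>H\<index>" 65)
  Zero :: "'o \<Rightarrow> 'o \<Rightarrow> 'm"

text \<open>The group law on a Hom-set is additive in the category but written
  multiplicatively as a HOL-Algebra monoid: \<open>inv\<close> is negation and \<open>finprod\<close> is a finite sum
  of morphisms.\<close>

definition Hom_group ::
  "('o, 'm, 'x) additive_category_scheme \<Rightarrow> 'o \<Rightarrow> 'o \<Rightarrow> 'm monoid" where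
  "Hom_group C X Y = \<lparr>carrier = Hom C X Y, monoid.mult = Add C, one = Zero C X Y\<rparr>"

definition Neg :: "('o, 'm, 'x) additive_category_scheme \<Rightarrow> 'm \<Rightarrow> 'm" where
  "Neg C f = inv\<^bsub>Hom_group C (Dom C f) (Cod C f)\<^esub> f"

text \<open>\<open>N\<close> is the direct sum of the objects \<open>A 0, \<dots>, A (k - 1)\<close>, with injections \<open>i\<close> and
  projections \<open>p\<close>. For \<open>k = 0\<close> this says that the identity of \<open>N\<close> is zero.\<close>

definition is_direct_sum ::
  "('o, 'm, 'x) additive_category_scheme \<Rightarrow> nat \<Rightarrow> (nat \<Rightarrow> 'o) \<Rightarrow> 'o
    \<Rightarrow> (nat \<Rightarrow> 'm) \<Rightarrow> (nat \<Rightarrow> 'm) \<Rightarrow> bool" where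
  "is_direct_sum C k A N i p \<longleftrightarrow>
    N \<in> Ob C \<and>
    (\<forall>j<k. A j \<in> Ob C \<and> i j \<in> Hom C (A j) N \<and> p j \<in> Hom C N (A j)) \<and>
    (\<forall>j<k. \<forall>l<k. Comp C (p l) (i j) = (if j = l then Id C (A j) else Zero C (A j) (A l))) \<and>
    finprod (Hom_group C N N) (\<lambda>j. Comp C (i j) (p j)) {..<k} = Id C N"

locale additive_category = category C
  for C :: "('o, 'm, 'x) additive_category_scheme" (structure) +
  assumes Hom_comm_group: "\<lbrakk>X \<in> Ob C; Y \<in> Ob C\<rbrakk> \<Longrightarrow> comm_group (Hom_group C X Y)"
    and Comp_Add_left:
      "\<lbrakk>f \<in> Hom C X Y; g \<in> Hom C Y Z; g' \<in> Hom C Y Z\<rbrakk>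
        \<Longrightarrow> (g \<oplus>\<^sub>H g') \<cdot> f = (g \<cdot> f) \<oplus>\<^sub>H (g' \<cdot> f)"
    and Comp_Add_right:
      "\<lbrakk>f \<in> Hom C X Y; f' \<in> Hom C X Y; g \<in> Hom C Y Z\<rbrakk>
        \<Longrightarrow> g \<cdot> (f \<oplus>\<^sub>H f') = (g \<cdot> f) \<oplus>\<^sub>H (g \<cdot> f')"
    and zero_object_exists: "\<exists>Z. is_zero_object C Z"
    and direct_sum_exists:
      "\<lbrakk>X \<in> Ob C; Y \<in> Ob C\<rbrakk>
        \<Longrightarrow> \<exists>N i p. is_direct_sum C 2 (\<lambda>j. if j = 0 then X else Y) N i p"

definition is_additive_functor ::
  "('o1, 'm1, 'x) additive_category_scheme \<Rightarrow> ('o2, 'm2, 'y) additive_category_scheme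
    \<Rightarrow> ('o1, 'm1, 'o2, 'm2) cfunctor \<Rightarrow> bool" where
  "is_additive_functor C D F \<longleftrightarrow> is_functor C D F \<and>
    (\<forall>X \<in> Ob C. \<forall>Y \<in> Ob C. \<forall>f \<in> Hom C X Y. \<forall>g \<in> Hom C X Y.
      onAr F (Add C f g) = Add D (onAr F f) (onAr F g))"

text \<open>The shift is an additive autoequivalence, with a chosen quasi-inverse \<open>Unshift\<close> giving a
  meaning to \<open>X[n]\<close> for negative \<open>n\<close>. The convention that the shift is an automorphism is the
  special case in which \<open>Unshift\<close> is its strict inverse. \<open>Tri\<close> is the class of
  distinguished triangles \<open>X \<rightarrow> Y \<rightarrow> Z \<rightarrow> X[1]\<close>, recorded as triples of morphisms.\<close>

record ('o, 'm) triangulated_category = "('o, 'm) additive_category" +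
  Shift :: "('o, 'm, 'o, 'm) cfunctor"
  Unshift :: "('o, 'm, 'o, 'm) cfunctor"
  Tri :: "('m \<times> 'm \<times> 'm) set"

definition is_triangle ::
  "('o, 'm, 'x) triangulated_category_scheme \<Rightarrow> 'm \<Rightarrow> 'm \<Rightarrow> 'm \<Rightarrow> bool" where
  "is_triangle C f g h \<longleftrightarrow>
    (\<exists>X \<in> Ob C. \<exists>Y \<in> Ob C. \<exists>Z \<in> Ob C.
      f \<in> Hom C X Y \<and> g \<in> Hom C Y Z \<and> h \<in> Hom C Z (onOb (Shift C) X))"

definition is_triangle_morphism ::
  "('o, 'm, 'x) triangulated_category_scheme \<Rightarrow> 'm \<times> 'm \<times> 'm \<Rightarrow> 'm \<times> 'm \<times> 'm
    \<Rightarrow> 'm \<Rightarrow> 'm \<Rightarrow> 'm \<Rightarrow> bool" where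
  "is_triangle_morphism C t t' a b c \<longleftrightarrow>
    (case (t, t') of ((f, g, h), (f', g', h')) \<Rightarrow>
      is_triangle C f g h \<and> is_triangle C f' g' h' \<and>
      a \<in> Hom C (Dom C f) (Dom C f') \<and>
      b \<in> Hom C (Dom C g) (Dom C g') \<and>
      c \<in> Hom C (Dom C h) (Dom C h') \<and>
      Comp C b f = Comp C f' a \<and>
      Comp C c g = Comp C g' b \<and>
      Comp C (onAr (Shift C) a) h = Comp C h' c)"

locale triangulated_category = additive_category C
  for C :: "('o, 'm, 'x) triangulated_category_scheme" (structure) +
  assumes Shift_additive: "is_additive_functor C C (Shift C)"
    and Unshift_functor: "is_functor C C (Unshift C)"
    and Unshift_Shift: "naturally_isomorphic C C (Unshift C \<circ>\<^sub>F Shift C) id_functor"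
    and Shift_Unshift: "naturally_isomorphic C C (Shift C \<circ>\<^sub>F Unshift C) id_functor"
    and Tri_is_triangle: "(f, g, h) \<in> Tri C \<Longrightarrow> is_triangle C f g h"
    and TR1_iso:
      "\<lbrakk>t \<in> Tri C; is_triangle_morphism C t t' a b c; is_iso C a; is_iso C b; is_iso C c\<rbrakk>
        \<Longrightarrow> t' \<in> Tri C"
    and TR1_id:
      "\<lbrakk>X \<in> Ob C; is_zero_object C Z\<rbrakk>
        \<Longrightarrow> (Id C X, Zero C X Z, Zero C Z (onOb (Shift C) X)) \<in> Tri C"
    and TR1_cone: "f \<in> Ar C \<Longrightarrow> \<exists>g h. (f, g, h) \<in> Tri C"
    and TR2:
      "is_triangle C f g h
        \<Longrightarrow> (f, g, h) \<in> Tri C \<longleftrightarrow> (g, h, Neg C (onAr (Shift C) f)) \<in> Tri C"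
    and TR3:
      "\<lbrakk>(f, g, h) \<in> Tri C; (f', g', h') \<in> Tri C;
        a \<in> Hom C (Dom C f) (Dom C f'); b \<in> Hom C (Cod C f) (Cod C f'); b \<cdot> f = f' \<cdot> a\<rbrakk>
        \<Longrightarrow> \<exists>c. is_triangle_morphism C (f, g, h) (f', g', h') a b c"
    and TR4:
      "\<lbrakk>f \<in> Hom C X Y; g \<in> Hom C Y Z;
        (f, p\<^sub>1, d\<^sub>1) \<in> Tri C; (g \<cdot> f, p\<^sub>2, d\<^sub>2) \<in> Tri C; (g, p\<^sub>3, d\<^sub>3) \<in> Tri C\<rbrakk>
        \<Longrightarrow> \<exists>a b.
          is_triangle_morphism C (f, p\<^sub>1, d\<^sub>1) (g \<cdot> f, p\<^sub>2, d\<^sub>2) (Id C X) g a \<and>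
          is_triangle_morphism C (g \<cdot> f, p\<^sub>2, d\<^sub>2) (g, p\<^sub>3, d\<^sub>3) f (Id C Z) b \<and>
          (a, b, onAr (Shift C) p\<^sub>1 \<cdot> d\<^sub>3) \<in> Tri C"

definition shift_by ::
  "('o, 'm, 'x) triangulated_category_scheme \<Rightarrow> int \<Rightarrow> 'o \<Rightarrow> 'o" where
  "shift_by C n X =
    (if 0 \<le> n then (onOb (Shift C) ^^ nat n) X else (onOb (Unshift C) ^^ nat (- n)) X)"

definition commutes_with_shifts ::
  "('o1, 'm1, 'x) triangulated_category_scheme \<Rightarrow> ('o2, 'm2, 'y) triangulated_category_scheme
    \<Rightarrow> ('o1, 'm1, 'o2, 'm2) cfunctor \<Rightarrow> bool" where
  "commutes_with_shifts C D F \<longleftrightarrow>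
    naturally_isomorphic C D (F \<circ>\<^sub>F Shift C) (Shift D \<circ>\<^sub>F F)"

text \<open>The subcategory \<open>\<langle>X\<rangle>\<^sub>1\<close>. Direct sums are determined only up to isomorphism, and \<open>N\<close>
  ranges over all of them, so the object set is closed under isomorphism.\<close>

definition gen_one ::
  "('o, 'm, 'x) triangulated_category_scheme \<Rightarrow> 'o \<Rightarrow> ('o, 'm) category" where
  "gen_one C X =
    full_subcategory C
      {Y \<in> Ob C. \<exists>k (n :: nat \<Rightarrow> int) N i p.
        is_direct_sum C k (\<lambda>j. shift_by C (n j) X) N i p \<and> is_retract_of C Y N}"

end

theory Submission imports Defs begin

text \<open>
  For an endofunctor \<open>P\<close> and a natural transformation \<open>\<eta> : 1 \<rightarrow> P\<close>, the objects at which \<open>\<eta>\<close> is a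
  split monomorphism are closed under retracts and finite direct sums: if \<open>r\<^sub>j\<close> splits \<open>\<eta>\<close> at the
  \<open>j\<close>-th summand, then \<open>\<Sum>\<^sub>j i\<^sub>j \<cdot> r\<^sub>j \<cdot> P p\<^sub>j\<close> splits it at the sum. Dually for \<open>\<epsilon> : P \<rightarrow> 1\<close>. By the
  triangle identities the unit splits on the image of \<open>R\<close> and the counit on the image of \<open>L\<close>, so
  only shifts remain. A shift of \<open>R B\<close> is a retract of some \<open>R B'\<close>. For the counit, the
  isomorphism of \<open>R[-1]\<close> with \<open>[-1]R\<close> has a mate through which \<open>\<epsilon>\<close> at \<open>X[-1]\<close> factors as \<open>\<epsilon>\<close> at
  \<open>X\<close>, shifted by \<open>-1\<close>; hence splitting passes from \<open>X[-1]\<close> to \<open>\<epsilon>\<^sub>X[-1]\<close> and, shifting back, to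
  \<open>X\<close>. The same argument applies with the shift and its inverse interchanged.
\<close>

section \<open>Split morphisms\<close>

lemma (in category) Hom_Ob:
  assumes "f \<in> Hom C X Y"
  shows "X \<in> Ob C" "Y \<in> Ob C"
  using assms Dom_in_Ob Cod_in_Ob by (auto simp: Hom_def)

lemma split_mono_iff:
  assumes "f \<in> Hom C X Y"
  shows "split_mono C f \<longleftrightarrow> (\<exists>r \<in> Hom C Y X. r \<cdot>\<^bsub>C\<^esub> f = Id C X)"
  using assms by (auto simp: split_mono_def Hom_def)

lemma split_epi_iff:
  assumes "f \<in> Hom C X Y"
  shows "split_epi C f \<longleftrightarrow> (\<exists>s \<in> Hom C Y X. f \<cdot>\<^bsub>C\<^esub> s = Id C Y)"
  using assms by (auto simp: split_epi_def Hom_def)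

lemma is_iso_iff:
  assumes "f \<in> Hom C X Y"
  shows "is_iso C f \<longleftrightarrow>
    (\<exists>g \<in> Hom C Y X. g \<cdot>\<^bsub>C\<^esub> f = Id C X \<and> f \<cdot>\<^bsub>C\<^esub> g = Id C Y)"
  using assms by (auto simp: is_iso_def Hom_def)

text \<open>If \<open>r\<close> is a left inverse of \<open>m\<close>, then
  \<open>p \<cdot> r \<cdot> b\<close> is one of \<open>m'\<close>: the square trades
  \<open>b \<cdot> m'\<close> for \<open>m \<cdot> i\<close>, then \<open>r\<close> cancels
  \<open>m\<close> and \<open>p\<close> cancels \<open>i\<close>.\<close>

lemma (in category) split_mono_retract:
  assumes m: "m \<in> Hom C B A" and m': "m' \<in> Hom C B' A'"
    and i: "i \<in> Hom C B' B" and p: "p \<in> Hom C B B'" and pi: "p \<cdot> i = Id C B'"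
    and b: "b \<in> Hom C A' A" and sq: "b \<cdot> m' = m \<cdot> i"
    and split: "split_mono C m"
  shows "split_mono C m'"
proof -
  obtain r where r: "r \<in> Hom C A B" "r \<cdot> m = Id C B"
    using split split_mono_iff[OF m] by auto
  have pr: "p \<cdot> r \<in> Hom C A B'" by (rule Comp_in_Hom[OF r(1) p])
  have "((p \<cdot> r) \<cdot> b) \<cdot> m' = (p \<cdot> r) \<cdot> (m \<cdot> i)"
    using Comp_assoc[OF m' b pr] sq by simp
  also have "\<dots> = p \<cdot> ((r \<cdot> m) \<cdot> i)"
    using Comp_assoc[OF Comp_in_Hom[OF i m] r(1) p] Comp_assoc[OF i m r(1)] by simp
  also have "\<dots> = Id C B'" using r(2) Comp_Id_left[OF i] pi by simp
  finally show ?thesis using split_mono_iff[OF m'] Comp_in_Hom[OF b pr] by blast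
qed

text \<open>Dually, a right inverse \<open>s\<close> of \<open>e\<close> yields the right inverse
  \<open>a \<cdot> s \<cdot> i\<close> of \<open>e'\<close>. Besides handling retracts of objects,
  this later cancels a right factor (with identities for \<open>i\<close> and \<open>p\<close>) and
  transports a splitting along an isomorphism.\<close>

lemma (in category) split_epi_retract:
  assumes e: "e \<in> Hom C A B" and e': "e' \<in> Hom C A' B'"
    and i: "i \<in> Hom C B' B" and p: "p \<in> Hom C B B'" and pi: "p \<cdot> i = Id C B'"
    and a: "a \<in> Hom C A A'" and sq: "e' \<cdot> a = p \<cdot> e"
    and split: "split_epi C e"
  shows "split_epi C e'"
proof -
  obtain s where s: "s \<in> Hom C B A" "e \<cdot> s = Id C B"
    using split split_epi_iff[OF e] by auto
  have si: "s \<cdot> i \<in> Hom C B' A" by (rule Comp_in_Hom[OF i s(1)])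
  have "e' \<cdot> (a \<cdot> (s \<cdot> i)) = (p \<cdot> e) \<cdot> (s \<cdot> i)"
    using Comp_assoc[OF si a e'] sq by simp
  also have "\<dots> = p \<cdot> ((e \<cdot> s) \<cdot> i)"
    using Comp_assoc[OF si e p] Comp_assoc[OF i s(1) e] by simp
  also have "\<dots> = Id C B'" using s(2) Comp_Id_left[OF i] pi by simp
  finally show ?thesis using split_epi_iff[OF e'] Comp_in_Hom[OF si a] by blast
qed

lemma (in category) is_retract_of_trans:
  assumes "is_retract_of C X Y" "is_retract_of C Y Z"
  shows "is_retract_of C X Z"
proof -
  obtain i p where ip: "i \<in> Hom C X Y" "p \<in> Hom C Y X" "p \<cdot> i = Id C X"
    using assms(1) by (auto simp: is_retract_of_def)
  obtain j q where jq: "j \<in> Hom C Y Z" "q \<in> Hom C Z Y" "q \<cdot> j = Id C Y"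
    using assms(2) by (auto simp: is_retract_of_def)
  have "(p \<cdot> q) \<cdot> (j \<cdot> i) = p \<cdot> ((q \<cdot> j) \<cdot> i)"
    using Comp_assoc[OF Comp_in_Hom[OF ip(1) jq(1)] jq(2) ip(2)]
      Comp_assoc[OF ip(1) jq(1) jq(2)] by simp
  also have "\<dots> = Id C X" using jq(3) ip Comp_Id_left[OF ip(1)] by simp
  finally show ?thesis
    using assms Comp_in_Hom[OF ip(1) jq(1)] Comp_in_Hom[OF jq(2) ip(2)]
    unfolding is_retract_of_def by blast
qed

lemma (in category) is_retract_of_refl: "X \<in> Ob C \<Longrightarrow> is_retract_of C X X"
  unfolding is_retract_of_def using Id_in_Hom Comp_Id_left by blast

section \<open>Functors and natural isomorphisms\<close>

lemma functor_Ob: "is_functor C D F \<Longrightarrow> X \<in> Ob C \<Longrightarrow> onOb F X \<in> Ob D"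
  by (simp add: is_functor_def)

lemma functor_Id: "is_functor C D F \<Longrightarrow> X \<in> Ob C \<Longrightarrow> onAr F (Id C X) = Id D (onOb F X)"
  by (simp add: is_functor_def)

lemma (in category) functor_Hom:
  "is_functor C D F \<Longrightarrow> f \<in> Hom C X Y \<Longrightarrow> onAr F f \<in> Hom D (onOb F X) (onOb F Y)"
  using Hom_Ob unfolding is_functor_def by blast

lemma (in category) functor_Comp:
  "is_functor C D F \<Longrightarrow> f \<in> Hom C X Y \<Longrightarrow> g \<in> Hom C Y Z
    \<Longrightarrow> onAr F (g \<cdot> f) = onAr F g \<cdot>\<^bsub>D\<^esub> onAr F f"
  using Hom_Ob unfolding is_functor_def by blast

lemma nat_trans_Hom:
  "is_nat_trans C D F G \<tau> \<Longrightarrow> X \<in> Ob C \<Longrightarrow> \<tau> X \<in> Hom D (onOb F X) (onOb G X)"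
  by (simp add: is_nat_trans_def)

lemma (in category) nat_trans_natural:
  "is_nat_trans C D F G \<tau> \<Longrightarrow> f \<in> Hom C X Y
    \<Longrightarrow> \<tau> Y \<cdot>\<^bsub>D\<^esub> onAr F f = onAr G f \<cdot>\<^bsub>D\<^esub> \<tau> X"
  using Hom_Ob unfolding is_nat_trans_def by blast

lemma comp_functor_simps [simp]:
  "onOb (G \<circ>\<^sub>F F) X = onOb G (onOb F X)" "onAr (G \<circ>\<^sub>F F) f = onAr G (onAr F f)"
  by (simp_all add: comp_functor_def)

lemma id_functor_simps [simp]: "onOb id_functor X = X" "onAr id_functor f = f"
  by (simp_all add: id_functor_def)

lemma comp_functor_assoc: "(H \<circ>\<^sub>F G) \<circ>\<^sub>F F = H \<circ>\<^sub>F (G \<circ>\<^sub>F F)"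
  by (simp add: comp_functor_def o_assoc)

lemma comp_functor_id: "id_functor \<circ>\<^sub>F F = F" "F \<circ>\<^sub>F id_functor = F"
  by (simp_all add: comp_functor_def id_functor_def o_def)

lemma (in category) is_functor_comp:
  assumes "is_functor C D F" "is_functor D E G"
  shows "is_functor C E (G \<circ>\<^sub>F F)"
  using assms unfolding is_functor_def by (simp, blast)

lemma (in category) functor_split_epi:
  assumes "is_functor C D F" "f \<in> Hom C X Y" "split_epi C f"
  shows "split_epi D (onAr F f)"
proof -
  obtain s where s: "s \<in> Hom C Y X" "f \<cdot> s = Id C Y"
    using assms(3) split_epi_iff[OF assms(2)] by blast
  have "onAr F f \<cdot>\<^bsub>D\<^esub> onAr F s = Id D (onOb F Y)"
    using functor_Comp[OF assms(1) s(1) assms(2)] s functor_Id[OF assms(1)] Hom_Ob by simp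
  then show ?thesis
    using split_epi_iff[OF functor_Hom[OF assms(1,2)]] functor_Hom[OF assms(1) s(1)] by blast
qed

lemma (in category) functor_retract:
  assumes F: "is_functor C D F" and "is_retract_of C X Y"
  shows "is_retract_of D (onOb F X) (onOb F Y)"
proof -
  obtain i p where ip: "i \<in> Hom C X Y" "p \<in> Hom C Y X" "p \<cdot> i = Id C X"
    using assms(2) by (auto simp: is_retract_of_def)
  have "onAr F p \<cdot>\<^bsub>D\<^esub> onAr F i = Id D (onOb F X)"
    using functor_Comp[OF F ip(1,2)] ip(3) functor_Id[OF F] Hom_Ob(1)[OF ip(1)] by simp
  then show ?thesis
    using functor_Hom[OF F ip(1)] functor_Hom[OF F ip(2)] functor_Ob[OF F] Hom_Ob[OF ip(1)]
    unfolding is_retract_of_def by blast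
qed

lemma (in category) functor_is_iso:
  assumes F: "is_functor C D F" and f: "f \<in> Hom C X Y" and "is_iso C f"
  shows "is_iso D (onAr F f)"
proof -
  obtain g where g: "g \<in> Hom C Y X" "g \<cdot> f = Id C X" "f \<cdot> g = Id C Y"
    using assms(3) is_iso_iff[OF f] by blast
  have "onAr F g \<cdot>\<^bsub>D\<^esub> onAr F f = Id D (onOb F X)"
    "onAr F f \<cdot>\<^bsub>D\<^esub> onAr F g = Id D (onOb F Y)"
    using functor_Comp[OF F f g(1)] functor_Comp[OF F g(1) f] g functor_Id[OF F] Hom_Ob[OF f]
    by simp_all
  then show ?thesis
    using is_iso_iff[OF functor_Hom[OF F f]] functor_Hom[OF F g(1)] by blast
qed

section \<open>Natural isomorphisms: composition, inversion and whiskering\<close>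

lemma naturally_isomorphic_retract:
  assumes "naturally_isomorphic C D F G" "X \<in> Ob C" "category D"
  shows "is_retract_of D (onOb F X) (onOb G X)"
proof -
  interpret D: category D by fact
  obtain \<tau> where \<tau>: "is_nat_trans C D F G \<tau>" "is_iso D (\<tau> X)"
    using assms by (auto simp: naturally_isomorphic_def)
  note h = nat_trans_Hom[OF \<tau>(1) assms(2)]
  show ?thesis
    using \<tau>(2) h D.Hom_Ob[OF h] unfolding is_iso_iff[OF h] is_retract_of_def by blast
qed

lemma (in category) is_iso_Comp:
  assumes f: "f \<in> Hom C X Y" and g: "g \<in> Hom C Y Z" and "is_iso C f" "is_iso C g"
  shows "is_iso C (g \<cdot> f)"
proof -
  obtain f' where f': "f' \<in> Hom C Y X" "f' \<cdot> f = Id C X" "f \<cdot> f' = Id C Y"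
    using \<open>is_iso C f\<close> is_iso_iff[OF f] by blast
  obtain g' where g': "g' \<in> Hom C Z Y" "g' \<cdot> g = Id C Y" "g \<cdot> g' = Id C Z"
    using \<open>is_iso C g\<close> is_iso_iff[OF g] by blast
  have "(f' \<cdot> g') \<cdot> (g \<cdot> f) = Id C X"
    using Comp_assoc[OF Comp_in_Hom[OF f g] g'(1) f'(1)] Comp_assoc[OF f g g'(1)]
      f' g' Comp_Id_left[OF f] by simp
  moreover have "(g \<cdot> f) \<cdot> (f' \<cdot> g') = Id C Z"
    using Comp_assoc[OF Comp_in_Hom[OF g'(1) f'(1)] f g] Comp_assoc[OF g'(1) f'(1) f]
      f' g' Comp_Id_left[OF g'(1)] by simp
  ultimately show ?thesis
    using is_iso_iff[OF Comp_in_Hom[OF f g]] Comp_in_Hom[OF g'(1) f'(1)] by blast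
qed

lemma naturally_isomorphic_trans:
  assumes D: "category D" and C: "category C"
    and FG: "naturally_isomorphic C D F G" and GH: "naturally_isomorphic C D G H"
    and F: "is_functor C D F" and G: "is_functor C D G" and H: "is_functor C D H"
  shows "naturally_isomorphic C D F H"
proof -
  interpret C: category C by fact
  interpret D: category D by fact
  obtain \<sigma> where \<sigma>: "is_nat_trans C D F G \<sigma>" "\<And>X. X \<in> Ob C \<Longrightarrow> is_iso D (\<sigma> X)"
    using FG by (auto simp: naturally_isomorphic_def)
  obtain \<tau> where \<tau>: "is_nat_trans C D G H \<tau>" "\<And>X. X \<in> Ob C \<Longrightarrow> is_iso D (\<tau> X)"
    using GH by (auto simp: naturally_isomorphic_def)
  let ?\<rho> = "\<lambda>X. \<tau> X \<cdot>\<^bsub>D\<^esub> \<sigma> X"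
  note \<sigma>h = nat_trans_Hom[OF \<sigma>(1)] and \<tau>h = nat_trans_Hom[OF \<tau>(1)]
  have "?\<rho> Y \<cdot>\<^bsub>D\<^esub> onAr F f = onAr H f \<cdot>\<^bsub>D\<^esub> ?\<rho> X" if f: "f \<in> Hom C X Y" for X Y f
  proof -
    note X = C.Hom_Ob(1)[OF f] and Y = C.Hom_Ob(2)[OF f]
    have "?\<rho> Y \<cdot>\<^bsub>D\<^esub> onAr F f = \<tau> Y \<cdot>\<^bsub>D\<^esub> (onAr G f \<cdot>\<^bsub>D\<^esub> \<sigma> X)"
      using D.Comp_assoc[OF C.functor_Hom[OF F f] \<sigma>h[OF Y] \<tau>h[OF Y]]
        C.nat_trans_natural[OF \<sigma>(1) f] by simp
    also have "\<dots> = (onAr H f \<cdot>\<^bsub>D\<^esub> \<tau> X) \<cdot>\<^bsub>D\<^esub> \<sigma> X"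
      using D.Comp_assoc[OF \<sigma>h[OF X] C.functor_Hom[OF G f] \<tau>h[OF Y]]
        C.nat_trans_natural[OF \<tau>(1) f] by simp
    also have "\<dots> = onAr H f \<cdot>\<^bsub>D\<^esub> ?\<rho> X"
      using D.Comp_assoc[OF \<sigma>h[OF X] \<tau>h[OF X] C.functor_Hom[OF H f]] by simp
    finally show ?thesis .
  qed
  then have "is_nat_trans C D F H ?\<rho>"
    unfolding is_nat_trans_def using D.Comp_in_Hom[OF \<sigma>h \<tau>h] by blast
  moreover have "is_iso D (?\<rho> X)" if "X \<in> Ob C" for X
    using D.is_iso_Comp[OF \<sigma>h \<tau>h] \<sigma>(2) \<tau>(2) that by blast
  ultimately show ?thesis unfolding naturally_isomorphic_def by blast
qed

text \<open>The pointwise inverses \<open>\<tau> X\<close> form a natural family: insert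
  \<open>\<sigma> X\<close> followed by its inverse, move \<open>f\<close> across by naturality of
  \<open>\<sigma>\<close>, and cancel \<open>\<tau> Y\<close> against
  \<open>\<sigma> Y\<close>.\<close>

lemma naturally_isomorphic_sym:
  assumes D: "category D" and C: "category C"
    and FG: "naturally_isomorphic C D F G"
    and F: "is_functor C D F" and G: "is_functor C D G"
  shows "naturally_isomorphic C D G F"
proof -
  interpret C: category C by fact
  interpret D: category D by fact
  obtain \<sigma> where \<sigma>: "is_nat_trans C D F G \<sigma>" "\<And>X. X \<in> Ob C \<Longrightarrow> is_iso D (\<sigma> X)"
    using FG by (auto simp: naturally_isomorphic_def)
  note \<sigma>h = nat_trans_Hom[OF \<sigma>(1)]
  have "\<forall>X \<in> Ob C. \<exists>g \<in> Hom D (onOb G X) (onOb F X).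
      g \<cdot>\<^bsub>D\<^esub> \<sigma> X = Id D (onOb F X) \<and> \<sigma> X \<cdot>\<^bsub>D\<^esub> g = Id D (onOb G X)"
    using \<sigma>(2) is_iso_iff[OF \<sigma>h] by blast
  then obtain \<tau> where \<tau>: "\<And>X. X \<in> Ob C \<Longrightarrow> \<tau> X \<in> Hom D (onOb G X) (onOb F X)"
      "\<And>X. X \<in> Ob C \<Longrightarrow> \<tau> X \<cdot>\<^bsub>D\<^esub> \<sigma> X = Id D (onOb F X)"
      "\<And>X. X \<in> Ob C \<Longrightarrow> \<sigma> X \<cdot>\<^bsub>D\<^esub> \<tau> X = Id D (onOb G X)"
    by metis
  have "\<tau> Y \<cdot>\<^bsub>D\<^esub> onAr G f = onAr F f \<cdot>\<^bsub>D\<^esub> \<tau> X" if f: "f \<in> Hom C X Y" for X Y f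
  proof -
    note X = C.Hom_Ob(1)[OF f] and Y = C.Hom_Ob(2)[OF f]
    note Ff = C.functor_Hom[OF F f] and Gf = C.functor_Hom[OF G f]
    have "\<tau> Y \<cdot>\<^bsub>D\<^esub> onAr G f = \<tau> Y \<cdot>\<^bsub>D\<^esub> (onAr G f \<cdot>\<^bsub>D\<^esub> (\<sigma> X \<cdot>\<^bsub>D\<^esub> \<tau> X))"
      using \<tau>(3)[OF X] D.Comp_Id_right[OF Gf] by simp
    also have "\<dots> = \<tau> Y \<cdot>\<^bsub>D\<^esub> ((\<sigma> Y \<cdot>\<^bsub>D\<^esub> onAr F f) \<cdot>\<^bsub>D\<^esub> \<tau> X)"
      using D.Comp_assoc[OF \<tau>(1)[OF X] \<sigma>h[OF X] Gf] C.nat_trans_natural[OF \<sigma>(1) f] by simp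
    also have "\<dots> = (\<tau> Y \<cdot>\<^bsub>D\<^esub> \<sigma> Y) \<cdot>\<^bsub>D\<^esub> (onAr F f \<cdot>\<^bsub>D\<^esub> \<tau> X)"
      using D.Comp_assoc[OF \<tau>(1)[OF X] Ff \<sigma>h[OF Y]]
        D.Comp_assoc[OF D.Comp_in_Hom[OF \<tau>(1)[OF X] Ff] \<sigma>h[OF Y] \<tau>(1)[OF Y]] by simp
    also have "\<dots> = onAr F f \<cdot>\<^bsub>D\<^esub> \<tau> X"
      using \<tau>(2)[OF Y] D.Comp_Id_left[OF D.Comp_in_Hom[OF \<tau>(1)[OF X] Ff]] by simp
    finally show ?thesis .
  qed
  then have "is_nat_trans C D G F \<tau>"
    unfolding is_nat_trans_def using \<tau>(1) by blast
  moreover have "is_iso D (\<tau> X)" if X: "X \<in> Ob C" for X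
    using is_iso_iff[OF \<tau>(1)[OF X]] \<tau>[OF X] \<sigma>h[OF X] by blast
  ultimately show ?thesis unfolding naturally_isomorphic_def by blast
qed

lemma naturally_isomorphic_whisker_right:
  assumes "naturally_isomorphic C D F G" "is_functor B C H" "category B"
  shows "naturally_isomorphic B D (F \<circ>\<^sub>F H) (G \<circ>\<^sub>F H)"
proof -
  interpret B: category B by fact
  obtain \<sigma> where "is_nat_trans C D F G \<sigma>" "\<And>X. X \<in> Ob C \<Longrightarrow> is_iso D (\<sigma> X)"
    using assms(1) by (auto simp: naturally_isomorphic_def)
  then show ?thesis
    unfolding naturally_isomorphic_def is_nat_trans_def
    using functor_Ob[OF assms(2)] B.functor_Hom[OF assms(2)]
    by (intro exI[of _ "\<lambda>X. \<sigma> (onOb H X)"]) simp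
qed

lemma naturally_isomorphic_whisker_left:
  assumes "naturally_isomorphic C D F G" "is_functor D E H" "is_functor C D F" "is_functor C D G"
    "category D" "category C"
  shows "naturally_isomorphic C E (H \<circ>\<^sub>F F) (H \<circ>\<^sub>F G)"
proof -
  interpret C: category C by fact
  interpret D: category D by fact
  obtain \<sigma> where \<sigma>: "is_nat_trans C D F G \<sigma>" "\<And>X. X \<in> Ob C \<Longrightarrow> is_iso D (\<sigma> X)"
    using assms(1) by (auto simp: naturally_isomorphic_def)
  note \<sigma>h = nat_trans_Hom[OF \<sigma>(1)]
  have "onAr H (\<sigma> Y) \<cdot>\<^bsub>E\<^esub> onAr H (onAr F f) = onAr H (onAr G f) \<cdot>\<^bsub>E\<^esub> onAr H (\<sigma> X)"
    if f: "f \<in> Hom C X Y" for X Y f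
    using D.functor_Comp[OF assms(2) C.functor_Hom[OF assms(3) f] \<sigma>h]
      D.functor_Comp[OF assms(2) \<sigma>h C.functor_Hom[OF assms(4) f]]
      C.nat_trans_natural[OF \<sigma>(1) f] C.Hom_Ob[OF f] by simp
  then show ?thesis
    unfolding naturally_isomorphic_def is_nat_trans_def
    using D.functor_Hom[OF assms(2) \<sigma>h] D.functor_is_iso[OF assms(2) \<sigma>h] \<sigma>(2)
    by (intro exI[of _ "\<lambda>X. onAr H (\<sigma> X)"]) simp
qed

section \<open>Natural transformations to and from the identity\<close>

text \<open>Naturality at the injection \<open>i\<close> supplies the square, with
  \<open>onAr P i\<close> as the map between the codomains.\<close>

lemma (in category) nat_trans_split_mono_retract:
  assumes P: "is_functor C C P" and \<eta>: "is_nat_trans C C id_functor P \<eta>"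
    and "is_retract_of C X Y" and split: "split_mono C (\<eta> Y)"
  shows "split_mono C (\<eta> X)"
proof -
  obtain i p where ip: "i \<in> Hom C X Y" "p \<in> Hom C Y X" "p \<cdot> i = Id C X"
    using assms(3) by (auto simp: is_retract_of_def)
  have \<eta>h: "\<eta> Z \<in> Hom C Z (onOb P Z)" if "Z \<in> Ob C" for Z
    using nat_trans_Hom[OF \<eta> that] by simp
  show ?thesis
    using split_mono_retract[OF \<eta>h \<eta>h ip functor_Hom[OF P ip(1)] _ split]
      nat_trans_natural[OF \<eta> ip(1)] Hom_Ob[OF ip(1)] by simp
qed

text \<open>Here naturality is taken at the projection \<open>p\<close>, and \<open>onAr P p\<close>
  is the map between the domains.\<close>

lemma (in category) nat_trans_split_epi_retract:
  assumes P: "is_functor C C P" and \<epsilon>: "is_nat_trans C C P id_functor \<epsilon>"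
    and "is_retract_of C X Y" and split: "split_epi C (\<epsilon> Y)"
  shows "split_epi C (\<epsilon> X)"
proof -
  obtain i p where ip: "i \<in> Hom C X Y" "p \<in> Hom C Y X" "p \<cdot> i = Id C X"
    using assms(3) by (auto simp: is_retract_of_def)
  have \<epsilon>h: "\<epsilon> Z \<in> Hom C (onOb P Z) Z" if "Z \<in> Ob C" for Z
    using nat_trans_Hom[OF \<epsilon> that] by simp
  show ?thesis
    using split_epi_retract[OF \<epsilon>h \<epsilon>h ip functor_Hom[OF P ip(2)] _ split]
      nat_trans_natural[OF \<epsilon> ip(2)] Hom_Ob[OF ip(1)] by simp
qed

section \<open>Finite sums of morphisms, and splitting on direct sums\<close>

lemma (in additive_category) Hom_group_simps [simp]:
  "carrier (Hom_group C X Y) = Hom C X Y" "f \<otimes>\<^bsub>Hom_group C X Y\<^esub> g = f \<oplus>\<^sub>H g"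
  by (simp_all add: Hom_group_def)

text \<open>Precomposition with \<open>f\<close> is a homomorphism of Hom-groups. The empty sum
  needs zero composed with \<open>f\<close> to be zero, which is obtained from
  \<open>hom_one\<close>; the induction step is distributivity.\<close>

lemma (in additive_category) finprod_comp_right:
  assumes "finite A" and f: "f \<in> Hom C X Y" and "Z \<in> Ob C"
    and h: "\<And>j. j \<in> A \<Longrightarrow> h j \<in> Hom C Y Z"
  shows "finprod (Hom_group C Y Z) h A \<cdot> f = finprod (Hom_group C X Z) (\<lambda>j. h j \<cdot> f) A"
proof -
  interpret YZ: comm_group "Hom_group C Y Z"
    using Hom_comm_group Hom_Ob[OF f] assms(3) by blast
  interpret XZ: comm_group "Hom_group C X Z"
    using Hom_comm_group Hom_Ob[OF f] assms(3) by blast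
  have hom: "(\<lambda>g. g \<cdot> f) \<in> hom (Hom_group C Y Z) (Hom_group C X Z)"
    using Comp_in_Hom[OF f] Comp_Add_left[OF f] by (auto intro!: homI)
  then interpret group_hom "Hom_group C Y Z" "Hom_group C X Z" "\<lambda>g. g \<cdot> f"
    by unfold_locales
  show ?thesis
    using assms(1) h
  proof (induction A rule: finite_induct)
    case empty
    then show ?case using hom_one by simp
  next
    case (insert a A)
    have ha: "h a \<in> Hom C Y Z" using insert.prems by simp
    have hA: "finprod (Hom_group C Y Z) h A \<in> Hom C Y Z"
      using YZ.finprod_closed[of h A] insert.prems by auto
    show ?case
      using insert.hyps insert.prems insert.IH Comp_in_Hom[OF f] Comp_Add_left[OF f ha hA]
      by (simp add: Pi_def)
  qed
qed

lemma (in additive_category) finprod_comp_left: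
  assumes "finite A" and f: "f \<in> Hom C Y Z" and "X \<in> Ob C"
    and h: "\<And>j. j \<in> A \<Longrightarrow> h j \<in> Hom C X Y"
  shows "f \<cdot> finprod (Hom_group C X Y) h A = finprod (Hom_group C X Z) (\<lambda>j. f \<cdot> h j) A"
proof -
  interpret XY: comm_group "Hom_group C X Y"
    using Hom_comm_group Hom_Ob[OF f] assms(3) by blast
  interpret XZ: comm_group "Hom_group C X Z"
    using Hom_comm_group Hom_Ob[OF f] assms(3) by blast
  have hom: "(\<lambda>g. f \<cdot> g) \<in> hom (Hom_group C X Y) (Hom_group C X Z)"
    using Comp_in_Hom[OF _ f] Comp_Add_right[OF _ _ f] by (auto intro!: homI)
  then interpret group_hom "Hom_group C X Y" "Hom_group C X Z" "\<lambda>g. f \<cdot> g"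
    by unfold_locales
  show ?thesis
    using assms(1) h
  proof (induction A rule: finite_induct)
    case empty
    then show ?case using hom_one by simp
  next
    case (insert a A)
    have ha: "h a \<in> Hom C X Y" using insert.prems by simp
    have hA: "finprod (Hom_group C X Y) h A \<in> Hom C X Y"
      using XY.finprod_closed[of h A] insert.prems by auto
    show ?case
      using insert.hyps insert.prems insert.IH Comp_in_Hom[OF _ f] Comp_Add_right[OF ha hA f]
      by (simp add: Pi_def)
  qed
qed

text \<open>The splitting is a sum in Hom(P N, N), formed after \<open>P\<close> has been applied to
  each projection separately, so a plain functor \<open>P\<close> suffices. Composed with
  \<open>\<eta> N\<close>, the summands become \<open>i j \<cdot> p j\<close>, whose sum is the
  identity. For \<open>k = 0\<close> both sums are empty.\<close>

lemma (in additive_category) nat_trans_split_mono_direct_sum: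
  assumes P: "is_functor C C P" and \<eta>: "is_nat_trans C C id_functor P \<eta>"
    and N: "is_direct_sum C k A N i p"
    and split: "\<And>j. j < k \<Longrightarrow> split_mono C (\<eta> (A j))"
  shows "split_mono C (\<eta> N)"
proof -
  have \<eta>h: "\<eta> Z \<in> Hom C Z (onOb P Z)" if "Z \<in> Ob C" for Z
    using nat_trans_Hom[OF \<eta> that] by simp
  have NOb: "N \<in> Ob C"
    and ip: "\<And>j. j < k \<Longrightarrow> A j \<in> Ob C" "\<And>j. j < k \<Longrightarrow> i j \<in> Hom C (A j) N"
      "\<And>j. j < k \<Longrightarrow> p j \<in> Hom C N (A j)"
    and sum: "finprod (Hom_group C N N) (\<lambda>j. i j \<cdot> p j) {..<k} = Id C N"
    using N by (auto simp: is_direct_sum_def)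
  have "\<forall>j<k. \<exists>r \<in> Hom C (onOb P (A j)) (A j). r \<cdot> \<eta> (A j) = Id C (A j)"
    using split split_mono_iff[OF \<eta>h] ip(1) by blast
  then obtain r where r: "\<And>j. j < k \<Longrightarrow> r j \<in> Hom C (onOb P (A j)) (A j)"
      "\<And>j. j < k \<Longrightarrow> r j \<cdot> \<eta> (A j) = Id C (A j)"
    by metis
  define h where "h j = i j \<cdot> (r j \<cdot> onAr P (p j))" for j
  have rP: "r j \<cdot> onAr P (p j) \<in> Hom C (onOb P N) (A j)" if "j < k" for j
    using Comp_in_Hom[OF functor_Hom[OF P ip(3)[OF that]] r(1)[OF that]] .
  have h: "h j \<in> Hom C (onOb P N) N" if "j < k" for j
    unfolding h_def using Comp_in_Hom[OF rP[OF that] ip(2)[OF that]] .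
  have h\<eta>: "h j \<cdot> \<eta> N = i j \<cdot> p j" if j: "j < k" for j
  proof -
    have "h j \<cdot> \<eta> N = i j \<cdot> (r j \<cdot> (onAr P (p j) \<cdot> \<eta> N))"
      unfolding h_def using Comp_assoc[OF \<eta>h[OF NOb] rP[OF j] ip(2)[OF j]]
        Comp_assoc[OF \<eta>h[OF NOb] functor_Hom[OF P ip(3)[OF j]] r(1)[OF j]] by simp
    \<comment> \<open>Naturality at \<open>p j\<close> moves \<open>\<eta>\<close> from
      \<open>N\<close> to the summand \<open>A j\<close>, where \<open>r j\<close> cancels
      it.\<close>
    also have "\<dots> = i j \<cdot> ((r j \<cdot> \<eta> (A j)) \<cdot> p j)"
      using nat_trans_natural[OF \<eta> ip(3)[OF j]]
        Comp_assoc[OF ip(3)[OF j] \<eta>h[OF ip(1)[OF j]] r(1)[OF j]] by simp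
    also have "\<dots> = i j \<cdot> p j" using r(2)[OF j] Comp_Id_left[OF ip(3)[OF j]] by simp
    finally show ?thesis .
  qed
  interpret NN: comm_group "Hom_group C N N" using Hom_comm_group NOb by blast
  interpret PN: comm_group "Hom_group C (onOb P N) N"
    using Hom_comm_group NOb functor_Ob[OF P] by blast
  have "finprod (Hom_group C (onOb P N) N) h {..<k} \<cdot> \<eta> N
      = finprod (Hom_group C N N) (\<lambda>j. h j \<cdot> \<eta> N) {..<k}"
    by (rule finprod_comp_right[OF _ \<eta>h[OF NOb] NOb]) (auto intro: h)
  also have "\<dots> = Id C N"
    unfolding sum[symmetric] using h\<eta> Comp_in_Hom[OF ip(3) ip(2)]
    by (intro NN.finprod_cong') auto
  finally show ?thesis
    using split_mono_iff[OF \<eta>h[OF NOb]] PN.finprod_closed[of h "{..<k}"] h by auto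
qed

lemma (in additive_category) nat_trans_split_epi_direct_sum:
  assumes P: "is_functor C C P" and \<epsilon>: "is_nat_trans C C P id_functor \<epsilon>"
    and N: "is_direct_sum C k A N i p"
    and split: "\<And>j. j < k \<Longrightarrow> split_epi C (\<epsilon> (A j))"
  shows "split_epi C (\<epsilon> N)"
proof -
  have \<epsilon>h: "\<epsilon> Z \<in> Hom C (onOb P Z) Z" if "Z \<in> Ob C" for Z
    using nat_trans_Hom[OF \<epsilon> that] by simp
  have NOb: "N \<in> Ob C"
    and ip: "\<And>j. j < k \<Longrightarrow> A j \<in> Ob C" "\<And>j. j < k \<Longrightarrow> i j \<in> Hom C (A j) N"
      "\<And>j. j < k \<Longrightarrow> p j \<in> Hom C N (A j)"
    and sum: "finprod (Hom_group C N N) (\<lambda>j. i j \<cdot> p j) {..<k} = Id C N"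
    using N by (auto simp: is_direct_sum_def)
  have "\<forall>j<k. \<exists>s \<in> Hom C (A j) (onOb P (A j)). \<epsilon> (A j) \<cdot> s = Id C (A j)"
    using split split_epi_iff[OF \<epsilon>h] ip(1) by blast
  then obtain s where s: "\<And>j. j < k \<Longrightarrow> s j \<in> Hom C (A j) (onOb P (A j))"
      "\<And>j. j < k \<Longrightarrow> \<epsilon> (A j) \<cdot> s j = Id C (A j)"
    by metis
  \<comment> \<open>Project to the \<open>j\<close>-th summand, lift by the section there, and
    include into \<open>P N\<close>; naturality at \<open>i j\<close> makes
    \<open>\<epsilon> N\<close> undo the lift.\<close>
  define h where "h j = onAr P (i j) \<cdot> (s j \<cdot> p j)" for j
  have sp: "s j \<cdot> p j \<in> Hom C N (onOb P (A j))" if "j < k" for j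
    using Comp_in_Hom[OF ip(3)[OF that] s(1)[OF that]] .
  have Pi: "onAr P (i j) \<in> Hom C (onOb P (A j)) (onOb P N)" if "j < k" for j
    using functor_Hom[OF P ip(2)[OF that]] .
  have h: "h j \<in> Hom C N (onOb P N)" if "j < k" for j
    unfolding h_def using Comp_in_Hom[OF sp[OF that] Pi[OF that]] .
  have \<epsilon>h_eq: "\<epsilon> N \<cdot> h j = i j \<cdot> p j" if j: "j < k" for j
  proof -
    have "\<epsilon> N \<cdot> h j = (\<epsilon> N \<cdot> onAr P (i j)) \<cdot> (s j \<cdot> p j)"
      unfolding h_def using Comp_assoc[OF sp[OF j] Pi[OF j] \<epsilon>h[OF NOb]] by simp
    also have "\<dots> = i j \<cdot> (\<epsilon> (A j) \<cdot> (s j \<cdot> p j))"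
      using nat_trans_natural[OF \<epsilon> ip(2)[OF j]]
        Comp_assoc[OF sp[OF j] \<epsilon>h[OF ip(1)[OF j]] ip(2)[OF j]] by simp
    also have "\<dots> = i j \<cdot> p j"
      using Comp_assoc[OF ip(3)[OF j] s(1)[OF j] \<epsilon>h[OF ip(1)[OF j]]]
        s(2)[OF j] Comp_Id_left[OF ip(3)[OF j]] by simp
    finally show ?thesis .
  qed
  interpret NN: comm_group "Hom_group C N N" using Hom_comm_group NOb by blast
  interpret NP: comm_group "Hom_group C N (onOb P N)"
    using Hom_comm_group NOb functor_Ob[OF P] by blast
  have "\<epsilon> N \<cdot> finprod (Hom_group C N (onOb P N)) h {..<k}
      = finprod (Hom_group C N N) (\<lambda>j. \<epsilon> N \<cdot> h j) {..<k}"
    by (rule finprod_comp_left[OF _ \<epsilon>h[OF NOb] NOb]) (auto intro: h)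
  also have "\<dots> = Id C N"
    unfolding sum[symmetric] using \<epsilon>h_eq Comp_in_Hom[OF ip(3) ip(2)]
    by (intro NN.finprod_cong') auto
  finally show ?thesis
    using split_epi_iff[OF \<epsilon>h[OF NOb]] NP.finprod_closed[of h "{..<k}"] h by auto
qed

section \<open>Adjunctions and shifts\<close>

text \<open>\<open>F\<close> and \<open>G\<close> are to be the shift and its quasi-inverse of
  \<open>T\<close>, in either order, and \<open>G'\<close> is the functor on \<open>S\<close> that
  matches \<open>G\<close>. Since \<open>G (F X)\<close> is isomorphic to \<open>X\<close>, the
  counit splits at \<open>G (F X)\<close>; it factors through \<open>G\<close> applied to the counit
  at \<open>F X\<close>, and applying \<open>F\<close> recovers the counit at \<open>F X\<close> up
  to isomorphism.\<close>

lemma adjunction_split_epi_counit: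
  assumes S: "category S" and T: "category T" and adj: "is_adjunction S T L R \<eta> \<epsilon>"
    and F: "is_functor T T F" and G: "is_functor T T G" and G': "is_functor S S G'"
    and FG: "naturally_isomorphic T T (F \<circ>\<^sub>F G) id_functor"
    and GF: "naturally_isomorphic T T (G \<circ>\<^sub>F F) id_functor"
    and GR: "naturally_isomorphic T S (G' \<circ>\<^sub>F R) (R \<circ>\<^sub>F G)"
    and X: "X \<in> Ob T" and split: "split_epi T (\<epsilon> X)"
  shows "split_epi T (\<epsilon> (onOb F X))"
proof -
  interpret S: category S by fact
  interpret T: category T by fact
  have L: "is_functor S T L" and R: "is_functor T S R"
    and \<eta>: "is_nat_trans S S id_functor (R \<circ>\<^sub>F L) \<eta>"
    and \<epsilon>: "is_nat_trans T T (L \<circ>\<^sub>F R) id_functor \<epsilon>"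
    using adj by (simp_all add: is_adjunction_def)
  have \<eta>h: "\<eta> M \<in> Hom S M (onOb R (onOb L M))" if "M \<in> Ob S" for M
    using nat_trans_Hom[OF \<eta> that] by simp
  have \<epsilon>h: "\<epsilon> B \<in> Hom T (onOb L (onOb R B)) B" if "B \<in> Ob T" for B
    using nat_trans_Hom[OF \<epsilon> that] by simp
  define B where "B = onOb F X"
  define Q where "Q = onOb L (onOb R B)"
  have B: "B \<in> Ob T" unfolding B_def by (rule functor_Ob[OF F X])
  have Q: "Q \<in> Ob T" unfolding Q_def by (intro functor_Ob[OF L] functor_Ob[OF R] B)
  note RB = functor_Ob[OF R B]
  have \<eta>B: "\<eta> (onOb R B) \<in> Hom S (onOb R B) (onOb R Q)" using \<eta>h[OF RB] by (simp add: Q_def)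
  have \<epsilon>B: "\<epsilon> B \<in> Hom T Q B" using \<epsilon>h[OF B] by (simp add: Q_def)
  note G\<epsilon> = T.functor_Hom[OF G \<epsilon>B]
  note RG\<epsilon> = T.functor_Hom[OF R G\<epsilon>]
  note GB = functor_Ob[OF G B] and GQ = functor_Ob[OF G Q]
  obtain \<sigma> where \<sigma>: "is_nat_trans T S (G' \<circ>\<^sub>F R) (R \<circ>\<^sub>F G) \<sigma>"
      "\<And>Y. Y \<in> Ob T \<Longrightarrow> is_iso S (\<sigma> Y)"
    using GR by (auto simp: naturally_isomorphic_def)
  have \<sigma>h: "\<sigma> Y \<in> Hom S (onOb G' (onOb R Y)) (onOb R (onOb G Y))" if "Y \<in> Ob T" for Y
    using nat_trans_Hom[OF \<sigma>(1) that] by simp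
  obtain \<rho> where \<rho>: "\<rho> \<in> Hom S (onOb R (onOb G B)) (onOb G' (onOb R B))"
      "\<sigma> B \<cdot>\<^bsub>S\<^esub> \<rho> = Id S (onOb R (onOb G B))"
    using \<sigma>(2)[OF B] is_iso_iff[OF \<sigma>h[OF B]] by blast
  note G'\<eta> = S.functor_Hom[OF G' \<eta>B]
  \<comment> \<open>\<open>w : L R G B \<rightarrow> G L R B\<close> is the transpose of \<open>R G B \<cong> G' R B \<rightarrow> G' R L R B \<cong> R G L R B\<close>.\<close>
  define v where "v = onAr G' (\<eta> (onOb R B)) \<cdot>\<^bsub>S\<^esub> \<rho>"
  have v: "v \<in> Hom S (onOb R (onOb G B)) (onOb G' (onOb R Q))"
    unfolding v_def by (rule S.Comp_in_Hom[OF \<rho>(1) G'\<eta>])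
  define u where "u = \<sigma> Q \<cdot>\<^bsub>S\<^esub> v"
  have u: "u \<in> Hom S (onOb R (onOb G B)) (onOb R (onOb G Q))"
    unfolding u_def by (rule S.Comp_in_Hom[OF v \<sigma>h[OF Q]])
  have R\<epsilon>: "onAr R (\<epsilon> B) \<in> Hom S (onOb R Q) (onOb R B)" by (rule T.functor_Hom[OF R \<epsilon>B])
  note G'R\<epsilon> = S.functor_Hom[OF G' R\<epsilon>]
  \<comment> \<open>This is \<open>G'\<close> applied to a triangle identity.\<close>
  have G'id: "onAr G' (onAr R (\<epsilon> B)) \<cdot>\<^bsub>S\<^esub> onAr G' (\<eta> (onOb R B)) = Id S (onOb G' (onOb R B))"
    using S.functor_Comp[OF G' \<eta>B R\<epsilon>] adj B functor_Id[OF G' RB]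
    by (simp add: is_adjunction_def)
  \<comment> \<open>Naturality of \<open>\<sigma>\<close> at \<open>\<epsilon> B\<close> exchanges
    \<open>R G\<close> for \<open>G' R\<close>, so that the triangle identity under
    \<open>G'\<close> can cancel the unit inside \<open>v\<close>.\<close>
  have "onAr R (onAr G (\<epsilon> B)) \<cdot>\<^bsub>S\<^esub> u = \<sigma> B \<cdot>\<^bsub>S\<^esub> (onAr G' (onAr R (\<epsilon> B)) \<cdot>\<^bsub>S\<^esub> v)"
    unfolding u_def
    using S.Comp_assoc[OF v \<sigma>h[OF Q] RG\<epsilon>] S.Comp_assoc[OF v G'R\<epsilon> \<sigma>h[OF B]]
      T.nat_trans_natural[OF \<sigma>(1) \<epsilon>B] by simp
  also have "onAr G' (onAr R (\<epsilon> B)) \<cdot>\<^bsub>S\<^esub> v = \<rho>"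
    unfolding v_def using S.Comp_assoc[OF \<rho>(1) G'\<eta> G'R\<epsilon>] G'id S.Comp_Id_left[OF \<rho>(1)] by simp
  finally have RGu: "onAr R (onAr G (\<epsilon> B)) \<cdot>\<^bsub>S\<^esub> u = Id S (onOb R (onOb G B))"
    using \<rho>(2) by simp
  note Lu = S.functor_Hom[OF L u] and LRG\<epsilon> = S.functor_Hom[OF L RG\<epsilon>]
  define w where "w = \<epsilon> (onOb G Q) \<cdot>\<^bsub>T\<^esub> onAr L u"
  have w: "w \<in> Hom T (onOb L (onOb R (onOb G B))) (onOb G Q)"
    unfolding w_def by (rule T.Comp_in_Hom[OF Lu \<epsilon>h[OF GQ]])
  \<comment> \<open>Naturality of \<open>\<epsilon>\<close> at \<open>onAr G (\<epsilon> B)\<close>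
    moves that arrow under \<open>L R\<close>, where it meets \<open>onAr L u\<close>; by
    \<open>RGu\<close> their composite is \<open>L\<close> of an identity.\<close>
  have "onAr G (\<epsilon> B) \<cdot>\<^bsub>T\<^esub> w
      = \<epsilon> (onOb G B) \<cdot>\<^bsub>T\<^esub> (onAr L (onAr R (onAr G (\<epsilon> B))) \<cdot>\<^bsub>T\<^esub> onAr L u)"
    unfolding w_def
    using T.Comp_assoc[OF Lu \<epsilon>h[OF GQ] G\<epsilon>] T.Comp_assoc[OF Lu LRG\<epsilon> \<epsilon>h[OF GB]]
      T.nat_trans_natural[OF \<epsilon> G\<epsilon>] by simp
  also have "\<dots> = \<epsilon> (onOb G B)"
    using S.functor_Comp[OF L u RG\<epsilon>] RGu functor_Id[OF L functor_Ob[OF R GB]]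
      T.Comp_Id_right[OF \<epsilon>h[OF GB]] by simp
  finally have sq: "onAr G (\<epsilon> B) \<cdot>\<^bsub>T\<^esub> w = \<epsilon> (onOb G B)" .
  have "is_retract_of T (onOb G B) X"
    using naturally_isomorphic_retract[OF GF X T] by (simp add: B_def)
  then have "split_epi T (\<epsilon> (onOb G B))"
    using T.nat_trans_split_epi_retract[OF T.is_functor_comp[OF R L] \<epsilon> _ split] by blast
  \<comment> \<open>With identities as \<open>i\<close> and \<open>p\<close>, the retract lemma says
    that a left factor of a split epimorphism is itself split.\<close>
  then have "split_epi T (onAr G (\<epsilon> B))"
    using T.split_epi_retract[OF \<epsilon>h[OF GB] G\<epsilon> T.Id_in_Hom[OF GB] T.Id_in_Hom[OF GB] _ w]
      sq T.Comp_Id_left[OF T.Id_in_Hom[OF GB]] T.Comp_Id_left[OF \<epsilon>h[OF GB]] by simp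
  then have FG\<epsilon>: "split_epi T (onAr F (onAr G (\<epsilon> B)))"
    by (rule T.functor_split_epi[OF F G\<epsilon>])
  obtain \<kappa> where \<kappa>: "is_nat_trans T T (F \<circ>\<^sub>F G) id_functor \<kappa>"
      "\<And>Y. Y \<in> Ob T \<Longrightarrow> is_iso T (\<kappa> Y)"
    using FG by (auto simp: naturally_isomorphic_def)
  have \<kappa>h: "\<kappa> Y \<in> Hom T (onOb F (onOb G Y)) Y" if "Y \<in> Ob T" for Y
    using nat_trans_Hom[OF \<kappa>(1) that] by simp
  obtain \<kappa>' where \<kappa>': "\<kappa>' \<in> Hom T B (onOb F (onOb G B))" "\<kappa> B \<cdot>\<^bsub>T\<^esub> \<kappa>' = Id T B"
    using \<kappa>(2)[OF B] is_iso_iff[OF \<kappa>h[OF B]] by blast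
  show ?thesis
    \<comment> \<open>Naturality of \<open>\<kappa>\<close> makes \<open>\<epsilon> B\<close> a
      retract of its image under \<open>F G\<close>: \<open>\<kappa>\<close> gives the projections
      and \<open>\<kappa>'\<close> the inclusion of \<open>B\<close>.\<close>
    unfolding B_def[symmetric]
    using T.split_epi_retract[OF T.functor_Hom[OF F G\<epsilon>] \<epsilon>B \<kappa>'(1) \<kappa>h[OF B] \<kappa>'(2) \<kappa>h[OF Q] _ FG\<epsilon>]
      T.nat_trans_natural[OF \<kappa>(1) \<epsilon>B] by simp
qed

section \<open>Shifts by arbitrary integers\<close>

lemma funpow_invariant:
  assumes "Q x" "\<And>x. Q x \<Longrightarrow> Q (f x)"
  shows "Q ((f ^^ n) x)"
  using assms by (induction n) auto

lemma shift_by_invariant: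
  assumes "Q X" "\<And>X. Q X \<Longrightarrow> Q (onOb (Shift C) X)" "\<And>X. Q X \<Longrightarrow> Q (onOb (Unshift C) X)"
  shows "Q (shift_by C n X)"
  unfolding shift_by_def using assms by (auto intro!: funpow_invariant[where Q = Q])

lemma Ob_gen_one:
  "Y \<in> Ob (gen_one C X) \<longleftrightarrow> Y \<in> Ob C \<and>
    (\<exists>k n N i p. is_direct_sum C k (\<lambda>j. shift_by C (n j) X) N i p \<and> is_retract_of C Y N)"
  by (simp add: gen_one_def full_subcategory_def)

text \<open>Composite of the chain \<open>[-1] F\<close>, \<open>[-1] F [1] [-1]\<close>,
  \<open>[-1] [1] F [-1]\<close>, \<open>F [-1]\<close>: insert \<open>[1] [-1]\<close> on the
  right, commute \<open>F\<close> past \<open>[1]\<close>, and cancel \<open>[-1] [1]\<close> on the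
  left.\<close>

lemma commutes_with_unshifts:
  assumes "triangulated_category C" "triangulated_category D" "is_functor C D F"
    and "commutes_with_shifts C D F"
  shows "naturally_isomorphic C D (Unshift D \<circ>\<^sub>F F) (F \<circ>\<^sub>F Unshift C)"
proof -
  interpret C: triangulated_category C by fact
  interpret D: triangulated_category D by fact
  note F = assms(3)
  have \<Sigma>: "is_functor C C (Shift C)" "is_functor D D (Shift D)"
    using C.Shift_additive D.Shift_additive by (auto simp: is_additive_functor_def)
  note U = C.Unshift_functor D.Unshift_functor
  note cats = D.category_axioms C.category_axioms
  note UF = C.is_functor_comp[OF F U(2)] and FU = C.is_functor_comp[OF U(1) F]
    and F\<Sigma> = C.is_functor_comp[OF \<Sigma>(1) F] and \<Sigma>F = C.is_functor_comp[OF F \<Sigma>(2)]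
    and \<Sigma>U = C.is_functor_comp[OF U(1) \<Sigma>(1)] and U\<Sigma> = D.is_functor_comp[OF \<Sigma>(2) U(2)]
  \<comment> \<open>These state functoriality of the two middle terms of the chain.\<close>
  note mid = C.is_functor_comp[OF \<Sigma>U UF] and mid' = C.is_functor_comp[OF FU U\<Sigma>]
  have id: "is_functor C C id_functor" by (simp add: is_functor_def)
  have "naturally_isomorphic C D ((Unshift D \<circ>\<^sub>F F) \<circ>\<^sub>F (Shift C \<circ>\<^sub>F Unshift C))
      ((Unshift D \<circ>\<^sub>F F) \<circ>\<^sub>F id_functor)"
    by (rule naturally_isomorphic_whisker_left[OF C.Shift_Unshift UF \<Sigma>U id
          C.category_axioms C.category_axioms])
  then have 1: "naturally_isomorphic C D (Unshift D \<circ>\<^sub>F F)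
      ((Unshift D \<circ>\<^sub>F F) \<circ>\<^sub>F (Shift C \<circ>\<^sub>F Unshift C))"
    using naturally_isomorphic_sym[OF cats _ mid UF] by (simp add: comp_functor_id)
  have "naturally_isomorphic C D (F \<circ>\<^sub>F Shift C) (Shift D \<circ>\<^sub>F F)"
    using assms(4) by (simp add: commutes_with_shifts_def)
  then have "naturally_isomorphic C D (Unshift D \<circ>\<^sub>F (F \<circ>\<^sub>F Shift C)) (Unshift D \<circ>\<^sub>F (Shift D \<circ>\<^sub>F F))"
    by (rule naturally_isomorphic_whisker_left[OF _ U(2) F\<Sigma> \<Sigma>F cats])
  from naturally_isomorphic_whisker_right[OF this U(1) C.category_axioms]
  have 2: "naturally_isomorphic C D ((Unshift D \<circ>\<^sub>F F) \<circ>\<^sub>F (Shift C \<circ>\<^sub>F Unshift C))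
      ((Unshift D \<circ>\<^sub>F Shift D) \<circ>\<^sub>F (F \<circ>\<^sub>F Unshift C))"
    by (simp only: comp_functor_assoc)
  have 3: "naturally_isomorphic C D ((Unshift D \<circ>\<^sub>F Shift D) \<circ>\<^sub>F (F \<circ>\<^sub>F Unshift C)) (F \<circ>\<^sub>F Unshift C)"
    using naturally_isomorphic_whisker_right[OF D.Unshift_Shift FU C.category_axioms]
    by (simp only: comp_functor_id)
  show ?thesis
    using naturally_isomorphic_trans[OF cats naturally_isomorphic_trans[OF cats 1 2 UF mid mid'] 3
        UF mid' FU] .
qed

theorem proposition3p4:
  fixes S :: "('o1, 'm1) triangulated_category"
    and T :: "('o2, 'm2) triangulated_category"
    and R :: "('o2, 'm2, 'o1, 'm1) cfunctor"
    and L :: "('o1, 'm1, 'o2, 'm2) cfunctor"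
    and \<eta> :: "'o1 \<Rightarrow> 'm1"
    and \<epsilon> :: "'o2 \<Rightarrow> 'm2"
  assumes "triangulated_category S"
    and "triangulated_category T"
    and "is_functor T S R"
    and "commutes_with_shifts T S R"
    and "is_adjunction S T L R \<eta> \<epsilon>"
  shows "(\<forall>M \<in> Ob S. \<forall>B \<in> Ob T. M \<in> Ob (gen_one S (onOb R B)) \<longrightarrow> split_mono S (\<eta> M)) \<and>
         (\<forall>M \<in> Ob S. \<forall>B \<in> Ob T. B \<in> Ob (gen_one T (onOb L M)) \<longrightarrow> split_epi T (\<epsilon> B))"
proof -
  interpret S: triangulated_category S by fact
  interpret T: triangulated_category T by fact
  note R = assms(3) and adj = assms(5)
  have L: "is_functor S T L"
    and \<eta>: "is_nat_trans S S id_functor (R \<circ>\<^sub>F L) \<eta>"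
    and \<epsilon>: "is_nat_trans T T (L \<circ>\<^sub>F R) id_functor \<epsilon>"
    using adj by (simp_all add: is_adjunction_def)
  note RL = S.is_functor_comp[OF L R] and LR = T.is_functor_comp[OF R L]
  have \<Sigma>: "is_functor S S (Shift S)" "is_functor T T (Shift T)"
    using S.Shift_additive T.Shift_additive by (auto simp: is_additive_functor_def)
  note U = S.Unshift_functor T.Unshift_functor
  \<comment> \<open>The assumed isomorphism is inverted so that it has the same direction as
    \<open>RU\<close> and both fit the hypothesis \<open>GR\<close> of the counit lemma.\<close>
  have R\<Sigma>: "naturally_isomorphic T S (Shift S \<circ>\<^sub>F R) (R \<circ>\<^sub>F Shift T)"
    using assms(4) naturally_isomorphic_sym[OF S.category_axioms T.category_axioms _
        T.is_functor_comp[OF \<Sigma>(2) R] T.is_functor_comp[OF R \<Sigma>(1)]]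
    by (simp add: commutes_with_shifts_def)
  note RU = commutes_with_unshifts[OF assms(2,1,3,4)]
  have R_image: "split_mono S (\<eta> (onOb R B))" if B: "B \<in> Ob T" for B
  proof -
    have h: "\<eta> (onOb R B) \<in> Hom S (onOb R B) (onOb R (onOb L (onOb R B)))"
      using nat_trans_Hom[OF \<eta> functor_Ob[OF R B]] by simp
    have "onAr R (\<epsilon> B) \<in> Hom S (onOb R (onOb L (onOb R B))) (onOb R B)"
      using T.functor_Hom[OF R nat_trans_Hom[OF \<epsilon> B]] by simp
    moreover have "onAr R (\<epsilon> B) \<cdot>\<^bsub>S\<^esub> \<eta> (onOb R B) = Id S (onOb R B)"
      using adj B by (simp add: is_adjunction_def)
    ultimately show ?thesis using split_mono_iff[OF h] by blast
  qed
  have L_image: "split_epi T (\<epsilon> (onOb L M))" if M: "M \<in> Ob S" for M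
  proof -
    have h: "\<epsilon> (onOb L M) \<in> Hom T (onOb L (onOb R (onOb L M))) (onOb L M)"
      using nat_trans_Hom[OF \<epsilon> functor_Ob[OF L M]] by simp
    have "onAr L (\<eta> M) \<in> Hom T (onOb L M) (onOb L (onOb R (onOb L M)))"
      using S.functor_Hom[OF L nat_trans_Hom[OF \<eta> M]] by simp
    moreover have "\<epsilon> (onOb L M) \<cdot>\<^bsub>T\<^esub> onAr L (\<eta> M) = Id T (onOb L M)"
      using adj M by (simp add: is_adjunction_def)
    ultimately show ?thesis using split_epi_iff[OF h] by blast
  qed
  have "split_mono S (\<eta> M)" if B: "B \<in> Ob T" and M: "M \<in> Ob (gen_one S (onOb R B))" for M B
  proof -
    \<comment> \<open>Retracts of objects in the image of \<open>R\<close> are stable under both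
      shift functors: if \<open>X\<close> is a retract of \<open>R Y\<close>, then
      \<open>G' X\<close> is a retract of \<open>G' R Y\<close>, which is isomorphic to
      \<open>R (G Y)\<close>. On them the unit splits by \<open>R_image\<close>.\<close>
    define Q where "Q X \<longleftrightarrow> (\<exists>Y \<in> Ob T. is_retract_of S X (onOb R Y))" for X
    have step: "Q (onOb G' X)"
      if "naturally_isomorphic T S (G' \<circ>\<^sub>F R) (R \<circ>\<^sub>F G)" "is_functor S S G'" "is_functor T T G" "Q X"
      for G G' X
      using that S.is_retract_of_trans[OF S.functor_retract]
        naturally_isomorphic_retract[OF that(1) _ S.category_axioms] functor_Ob[OF that(3)]
      unfolding Q_def by fastforce
    have "Q (onOb R B)"
      using B S.is_retract_of_refl[OF functor_Ob[OF R B]] unfolding Q_def by blast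
    then have "Q (shift_by S n (onOb R B))" for n
      using step[OF R\<Sigma> \<Sigma>] step[OF RU U] by (intro shift_by_invariant[where Q = Q])
    then have "split_mono S (\<eta> (shift_by S n (onOb R B)))" for n
      using S.nat_trans_split_mono_retract[OF RL \<eta>] R_image unfolding Q_def by blast
    then show ?thesis
      using M S.nat_trans_split_mono_direct_sum[OF RL \<eta>]
        S.nat_trans_split_mono_retract[OF RL \<eta>] unfolding Ob_gen_one by blast
  qed
  moreover have "split_epi T (\<epsilon> B)" if M: "M \<in> Ob S" and B: "B \<in> Ob (gen_one T (onOb L M))" for M B
  proof -
    define Q where "Q X \<longleftrightarrow> X \<in> Ob T \<and> split_epi T (\<epsilon> X)" for X
    note split = adjunction_split_epi_counit[OF S.category_axioms T.category_axioms adj]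
    have "Q (onOb L M)" using M L_image functor_Ob[OF L] unfolding Q_def by blast
    then have "Q (shift_by T n (onOb L M))" for n
      \<comment> \<open>Closure under the shift uses compatibility of \<open>R\<close> with the
        inverse shift, and closure under the inverse shift uses compatibility with the
        shift.\<close>
      using split[OF \<Sigma>(2) U(2,1) T.Shift_Unshift T.Unshift_Shift RU]
        split[OF U(2) \<Sigma>(2,1) T.Unshift_Shift T.Shift_Unshift R\<Sigma>]
        functor_Ob[OF \<Sigma>(2)] functor_Ob[OF U(2)]
      by (intro shift_by_invariant[where Q = Q]) (auto simp: Q_def)
    then show ?thesis
      using B T.nat_trans_split_epi_direct_sum[OF LR \<epsilon>]
        T.nat_trans_split_epi_retract[OF LR \<epsilon>] unfolding Ob_gen_one Q_def by blast
  qed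
  ultimately show ?thesis by blast
qed

end
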